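(* Let $\phi: R\rightarrow R'$ be a morphism of commutative rings, and let $\phi^{\ast}:\operatorname{Spec}(R')\rightarrow\operatorname{Spec}(R)$, $\mathfrak{p}\mapsto\phi^{-1}(\mathfrak{p})$, be the induced map. Then $\phi$ lifts idempotents if and only if the induced map $\operatorname{Clop}(\phi^{\ast}):\operatorname{Clop}\big(\operatorname{Spec}(R)\big)\rightarrow\operatorname{Clop}\big(\operatorname{Spec}(R')\big)$, $U\mapsto(\phi^{\ast})^{-1}(U)$, is surjective.
   Context: All rings are commutative with $1$. A morphism of rings $\phi:R\rightarrow R'$ lifts idempotents if for every idempotent $e'\in R'$ there exists an idempotent $e\in R$ with $\phi(e)=e'$. For a topological space $X$, $\operatorname{Clop}(X)$ denotes the set of clopen (both open and closed) subsets of $X$. Prime spectra carry the Zariski topology. *)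

theory Defs
  imports "HOL-Analysis.Abstract_Topology" "HOL-Algebra.QuotRing"
begin

definition idempotents :: "('a, 'm) ring_scheme \<Rightarrow> 'a set" where
  "idempotents R = {e \<in> carrier R. e \<otimes>\<^bsub>R\<^esub> e = e}"

definition lifts_idempotents ::
  "('a, 'm) ring_scheme \<Rightarrow> ('b, 'n) ring_scheme \<Rightarrow> ('a \<Rightarrow> 'b) \<Rightarrow> bool" where
  "lifts_idempotents R S \<phi> \<longleftrightarrow> (\<forall>e' \<in> idempotents S. \<exists>e \<in> idempotents R. \<phi> e = e')"

definition prime_ideals :: "('a, 'm) ring_scheme \<Rightarrow> 'a set set" where
  "prime_ideals R = {p. primeideal p R}"

definition zero_locus :: "('a, 'm) ring_scheme \<Rightarrow> 'a set \<Rightarrow> 'a set set" where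
  "zero_locus R E = {p \<in> prime_ideals R. E \<subseteq> p}"

text \<open>The prime spectrum with the Zariski topology: the closed sets are exactly the sets
  \<open>zero_locus R E\<close> (see \<open>closedin_Spec\<close> below).\<close>

definition Spec :: "('a, 'm) ring_scheme \<Rightarrow> 'a set topology" where
  "Spec R = topology (\<lambda>U. \<exists>E \<subseteq> carrier R. U = prime_ideals R - zero_locus R E)"

definition spec_map ::
  "('a, 'm) ring_scheme \<Rightarrow> ('a \<Rightarrow> 'b) \<Rightarrow> 'b set \<Rightarrow> 'a set" where
  "spec_map R \<phi> p = {r \<in> carrier R. \<phi> r \<in> p}"

definition Clop :: "'a topology \<Rightarrow> 'a set set" where
  "Clop X = {U. openin X U \<and> closedin X U}"

text \<open>The map that a continuous map \<open>f\<close> with domain \<open>X\<close> induces on clopen sets. The preimage is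
  taken within \<open>topspace X\<close>, since \<open>f\<close> is a total function on the underlying type.\<close>

definition Clop_map :: "'a topology \<Rightarrow> ('a \<Rightarrow> 'b) \<Rightarrow> 'b set \<Rightarrow> 'a set" where
  "Clop_map X f U = {x \<in> topspace X. f x \<in> U}"

lemma zero_locus_Un:
  assumes "E \<subseteq> carrier R" "F \<subseteq> carrier R"
  shows "zero_locus R E \<union> zero_locus R F = zero_locus R {a \<otimes>\<^bsub>R\<^esub> b |a b. a \<in> E \<and> b \<in> F}"
    (is "?L = ?M")
proof
  show "?L \<subseteq> ?M"
  proof
    fix p assume p: "p \<in> ?L"
    then have "primeideal p R" by (auto simp: zero_locus_def prime_ideals_def)
    then interpret primeideal p R .
    have "a \<otimes>\<^bsub>R\<^esub> b \<in> p" if "a \<in> E" "b \<in> F" for a b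
    proof -
      have "a \<in> carrier R" "b \<in> carrier R" "a \<in> p \<or> b \<in> p"
        using that assms p by (auto simp: zero_locus_def)
      then show ?thesis using I_l_closed I_r_closed by blast
    qed
    then show "p \<in> ?M"
      using p by (auto simp: zero_locus_def)
  qed
  show "?M \<subseteq> ?L"
  proof
    fix p assume p: "p \<in> ?M"
    then have "primeideal p R" by (auto simp: zero_locus_def prime_ideals_def)
    then interpret primeideal p R .
    show "p \<in> ?L"
    proof (rule ccontr)
      assume "p \<notin> ?L"
      then obtain a b where "a \<in> E" "a \<notin> p" "b \<in> F" "b \<notin> p"
        using p by (auto simp: zero_locus_def)
      moreover from this have "a \<otimes>\<^bsub>R\<^esub> b \<in> p" using p by (auto simp: zero_locus_def)
      ultimately show False using I_prime assms by blast
    qed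
  qed
qed

lemma istopology_zariski:
  fixes R :: "('a, 'm) ring_scheme"
  assumes "cring R"
  shows "istopology (\<lambda>U. \<exists>E \<subseteq> carrier R. U = prime_ideals R - zero_locus R E)"
  unfolding istopology_def
proof (intro conjI allI impI)
  interpret cring R by (fact assms)
  fix S T
  assume "\<exists>E \<subseteq> carrier R. S = prime_ideals R - zero_locus R E"
    and "\<exists>E \<subseteq> carrier R. T = prime_ideals R - zero_locus R E"
  then obtain E F where EF: "E \<subseteq> carrier R" "F \<subseteq> carrier R"
    and ST: "S = prime_ideals R - zero_locus R E" "T = prime_ideals R - zero_locus R F"
    by blast
  have "S \<inter> T = prime_ideals R - (zero_locus R E \<union> zero_locus R F)"
    using ST by blast
  then have "S \<inter> T = prime_ideals R - zero_locus R {a \<otimes>\<^bsub>R\<^esub> b |a b. a \<in> E \<and> b \<in> F}"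
    using zero_locus_Un[OF EF] by simp
  moreover have "{a \<otimes>\<^bsub>R\<^esub> b |a b. a \<in> E \<and> b \<in> F} \<subseteq> carrier R"
    using EF by blast
  ultimately show "\<exists>E \<subseteq> carrier R. S \<inter> T = prime_ideals R - zero_locus R E"
    by blast
next
  fix \<K> :: "'a set set set"
  assume "\<forall>U \<in> \<K>. \<exists>E \<subseteq> carrier R. U = prime_ideals R - zero_locus R E"
  then obtain E where E: "\<And>U. U \<in> \<K> \<Longrightarrow> E U \<subseteq> carrier R"
    "\<And>U. U \<in> \<K> \<Longrightarrow> U = prime_ideals R - zero_locus R (E U)"
    by metis
  have "\<Union>\<K> = (\<Union>U \<in> \<K>. prime_ideals R - zero_locus R (E U))"
    using E(2) by auto
  also have "\<dots> = prime_ideals R - zero_locus R (\<Union>U \<in> \<K>. E U)"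
    by (auto simp: zero_locus_def)
  finally have "\<Union>\<K> = prime_ideals R - zero_locus R (\<Union>U \<in> \<K>. E U)" .
  moreover have "(\<Union>U \<in> \<K>. E U) \<subseteq> carrier R" using E(1) by blast
  ultimately show "\<exists>E \<subseteq> carrier R. \<Union>\<K> = prime_ideals R - zero_locus R E"
    by blast
qed

lemma openin_Spec:
  assumes "cring R"
  shows "openin (Spec R) U \<longleftrightarrow> (\<exists>E \<subseteq> carrier R. U = prime_ideals R - zero_locus R E)"
  by (simp add: Spec_def topology_inverse'[OF istopology_zariski[OF assms]])

lemma topspace_Spec:
  assumes "cring R"
  shows "topspace (Spec R) = prime_ideals R"
proof -
  interpret cring R by (fact assms)
  have "zero_locus R {\<one>\<^bsub>R\<^esub>} = {}"
  proof (rule ccontr)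
    assume "zero_locus R {\<one>\<^bsub>R\<^esub>} \<noteq> {}"
    then obtain p where p: "primeideal p R" "\<one>\<^bsub>R\<^esub> \<in> p"
      by (auto simp: zero_locus_def prime_ideals_def)
    then interpret primeideal p R by simp
    show False using one_imp_carrier[OF p(2)] I_notcarr by simp
  qed
  then have "openin (Spec R) (prime_ideals R)"
    unfolding openin_Spec[OF assms] by (intro exI[of _ "{\<one>\<^bsub>R\<^esub>}"]) simp
  moreover have "U \<subseteq> prime_ideals R" if "openin (Spec R) U" for U
    using that by (auto simp: openin_Spec[OF assms])
  ultimately show ?thesis
    by (meson openin_subset openin_topspace subset_antisym)
qed

lemma closedin_Spec:
  assumes "cring R"
  shows "closedin (Spec R) C \<longleftrightarrow> (\<exists>E \<subseteq> carrier R. C = zero_locus R E)"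
proof -
  have sub: "zero_locus R E \<subseteq> prime_ideals R" for E by (auto simp: zero_locus_def)
  show ?thesis
    unfolding closedin_def topspace_Spec[OF assms] openin_Spec[OF assms]
    using sub by (metis double_diff subset_refl)
qed

lemma continuous_map_spec_map:
  assumes "cring R" "cring S" "\<phi> \<in> ring_hom R S"
  shows "continuous_map (Spec S) (Spec R) (spec_map R \<phi>)"
proof -
  interpret ring_hom_ring R S \<phi>
    using assms by (simp add: ring_hom_ringI2 cring.axioms(1))
  have prime: "spec_map R \<phi> p \<in> prime_ideals R" if "p \<in> prime_ideals S" for p
    using primeideal_vimage[OF assms(1), of p] that by (simp add: spec_map_def prime_ideals_def)
  have "{p \<in> prime_ideals S. spec_map R \<phi> p \<in> zero_locus R E} = zero_locus S (\<phi> ` E)"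
    if "E \<subseteq> carrier R" for E
    using that prime by (auto simp: zero_locus_def spec_map_def)
  moreover have "\<phi> ` E \<subseteq> carrier S" if "E \<subseteq> carrier R" for E
    using that ring_hom_closed[OF assms(3)] by blast
  ultimately show ?thesis
    unfolding continuous_map_closedin closedin_Spec[OF assms(1)] closedin_Spec[OF assms(2)]
      topspace_Spec[OF assms(1)] topspace_Spec[OF assms(2)]
    using prime by (intro conjI allI impI funcsetI; metis)
qed

lemma Clop_map_in_Clop:
  assumes "continuous_map X Y f" "U \<in> Clop Y"
  shows "Clop_map X f U \<in> Clop X"
  using assms openin_continuous_map_preimage[of X Y f U] closedin_continuous_map_preimage[of X Y f U]
  by (simp add: Clop_def Clop_map_def)

end

theory Submission
  imports Defs "HOL-Algebra.Ring_Divisibility"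
begin

text \<open>An idempotent \<open>e\<close> defines the clopen set of primes not containing \<open>e\<close>. This assignment is
  natural in the ring, and it is a bijection between idempotents and clopen sets of the spectrum,
  so lifting idempotents along \<open>\<phi>\<close> is the same as lifting clopen sets along the induced map.

  Surjectivity: if \<open>V(E)\<close> and \<open>V(F)\<close> are complementary, then \<open>1 = a + b\<close> with \<open>a \<in> (E)\<close> and
  \<open>b \<in> (F)\<close>. The product \<open>ab\<close> lies in every prime, so \<open>a\<^sup>n b\<^sup>n = 0\<close> for some \<open>n\<close>; since no prime contains
  both \<open>a\<^sup>n\<close> and \<open>b\<^sup>n\<close>, we get \<open>1 = x a\<^sup>n + y b\<^sup>n\<close>, a decomposition of \<open>1\<close> into orthogonal idempotents.
  Injectivity: if \<open>e\<close> and \<open>f\<close> define the same set, then \<open>e(1 - f)\<close> is a nilpotent idempotent.\<close>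

definition basic_open :: "('a, 'm) ring_scheme \<Rightarrow> 'a \<Rightarrow> 'a set set" where
  "basic_open R a = {p \<in> prime_ideals R. a \<notin> p}"

lemma prime_idealsD: "p \<in> prime_ideals R \<Longrightarrow> primeideal p R"
  by (simp add: prime_ideals_def)

section \<open>Prime ideals, comaximality and nilpotents\<close>

lemma (in primeideal) one_not_mem: "\<one> \<notin> I"
  using one_imp_carrier I_notcarr by blast

text \<open>The exponent is positive because the zeroth power is \<open>\<one>\<close>, which no
  prime ideal contains.\<close>

lemma (in primeideal) nat_pow_mem_iff:
  assumes "a \<in> carrier R"
  shows "a [^] Suc n \<in> I \<longleftrightarrow> a \<in> I"
proof (induction n)
  case 0
  then show ?case using assms by simp
next
  case (Suc n)
  have "a [^] Suc (Suc n) = a [^] Suc n \<otimes> a" by simp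
  then show ?case
    using Suc I_prime[of "a [^] Suc n" a] I_l_closed[of a "a [^] Suc n"] assms by auto
qed

context cring
begin

text \<open>An ideal maximal among those disjoint from \<open>S\<close> is prime: otherwise both colon ideals below
  would meet \<open>S\<close>.\<close>

lemma exists_prime_avoiding:
  assumes I: "ideal I R" and S: "S \<subseteq> carrier R" "S \<noteq> {}" "I \<inter> S = {}"
    and mult: "\<And>s t. s \<in> S \<Longrightarrow> t \<in> S \<Longrightarrow> s \<otimes> t \<in> S"
  shows "\<exists>p \<in> prime_ideals R. I \<subseteq> p \<and> p \<inter> S = {}"
proof -
  define \<A> where "\<A> = {J. ideal J R \<and> I \<subseteq> J \<and> J \<inter> S = {}}"
  have "\<exists>M\<in>\<A>. \<forall>X\<in>\<A>. M \<subseteq> X \<longrightarrow> X = M"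
  proof (rule subset_Zorn_nonempty)
    show "\<A> \<noteq> {}" using I S unfolding \<A>_def by blast
    fix C assume C: "C \<noteq> {}" "subset.chain \<A> C"
    then have "subset.chain {J. ideal J R} C"
      unfolding pred_on.chain_def \<A>_def by blast
    from chain_Union_is_ideal[OF this] C(1) have "ideal (\<Union>C) R" by simp
    with C show "\<Union>C \<in> \<A>"
      unfolding pred_on.chain_def \<A>_def by blast
  qed
  then obtain M where M: "ideal M R" "I \<subseteq> M" "M \<inter> S = {}"
    and max: "\<And>J. ideal J R \<Longrightarrow> M \<subseteq> J \<Longrightarrow> J \<inter> S = {} \<Longrightarrow> J = M"
    unfolding \<A>_def by (smt (verit) mem_Collect_eq subset_trans)
  interpret M: ideal M R by (fact M(1))
  \<comment> \<open>The colon ideal of \<open>a\<close> contains \<open>M\<close> and also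
    \<open>b\<close>, so it is strictly larger; by maximality it cannot be disjoint from
    \<open>S\<close>.\<close>
  have colon: "\<exists>s \<in> S. a \<otimes> s \<in> M" if "a \<in> carrier R" "b \<in> carrier R" "a \<otimes> b \<in> M" "b \<notin> M" for a b
  proof (rule ccontr)
    assume "\<not> ?thesis"
    then have "{x \<in> carrier R. a \<otimes> x \<in> M} \<inter> S = {}" by blast
    moreover have "M \<subseteq> {x \<in> carrier R. a \<otimes> x \<in> M}"
      using that(1) M.I_l_closed M.Icarr by blast
    ultimately have "{x \<in> carrier R. a \<otimes> x \<in> M} = M"
      using max[OF M.helper_max_prime[OF is_cring that(1)]] by blast
    with that show False by blast
  qed
  have "primeideal M R"
  proof (rule primeidealI[OF M(1) is_cring])
    show "carrier R \<noteq> M" using S M by blast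
    fix a b assume ab: "a \<in> carrier R" "b \<in> carrier R" "a \<otimes> b \<in> M"
    show "a \<in> M \<or> b \<in> M"
    proof (rule ccontr)
      assume neg: "\<not> (a \<in> M \<or> b \<in> M)"
      \<comment> \<open>\<open>colon\<close> is used twice: \<open>b\<close> outside
        \<open>M\<close> yields \<open>s\<close>, then \<open>s\<close> takes the place of
        \<open>a\<close>, and \<open>a\<close> outside \<open>M\<close> yields
        \<open>t\<close>.\<close>
      then obtain s where s: "s \<in> S" "a \<otimes> s \<in> M" using colon ab by blast
      then have "s \<otimes> a \<in> M" using m_comm ab(1) S by (metis subsetD)
      then obtain t where "t \<in> S" "s \<otimes> t \<in> M" using colon[of s a] neg ab s S by blast
      then show False using mult s M by blast
    qed
  qed
  then show ?thesis using M by (auto simp: prime_ideals_def)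
qed

text \<open>A proper ideal misses the multiplicative set \<open>{\<one>}\<close>, so some prime
  would contain it.\<close>

lemma ideal_eq_carrier_if_no_prime:
  assumes I: "ideal I R" and "\<And>p. p \<in> prime_ideals R \<Longrightarrow> \<not> I \<subseteq> p"
  shows "I = carrier R"
proof (rule ccontr)
  assume "I \<noteq> carrier R"
  then have "I \<inter> {\<one>} = {}" using ideal.one_imp_carrier[OF I] by blast
  then have "\<exists>p \<in> prime_ideals R. I \<subseteq> p \<and> p \<inter> {\<one>} = {}"
    by (intro exists_prime_avoiding[OF I]) auto
  with assms(2) show False by blast
qed

lemma coprime_ideals_decompose_one:
  assumes I: "ideal I R" and J: "ideal J R"
    and no_prime: "\<And>p. p \<in> prime_ideals R \<Longrightarrow> I \<subseteq> p \<Longrightarrow> J \<subseteq> p \<Longrightarrow> False"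
  obtains a b where "a \<in> I" "b \<in> J" "a \<oplus> b = \<one>"
proof -
  have U: "I \<union> J \<subseteq> carrier R"
    using ideal.Icarr[OF I] ideal.Icarr[OF J] by blast
  have "Idl (I \<union> J) = carrier R"
    using no_prime genideal_self[OF U] by (intro ideal_eq_carrier_if_no_prime genideal_ideal U) blast
  then have "\<one> \<in> I <+> J"
    using union_genideal[OF I J] by simp
  then show ?thesis
    using that unfolding set_add_def' by auto
qed

text \<open>Otherwise the positive powers of \<open>a\<close> form a multiplicative set missing
  \<open>{\<zero>}\<close>, and a prime avoiding it would omit \<open>a\<close> itself.\<close>

lemma nilpotent_if_in_all_primes:
  assumes a: "a \<in> carrier R" and primes: "\<And>p. p \<in> prime_ideals R \<Longrightarrow> a \<in> p"
  shows "\<exists>n::nat. a [^] Suc n = \<zero>"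
proof (rule ccontr)
  let ?S = "{a [^] Suc n |n::nat. True}"
  assume neg: "\<nexists>n::nat. a [^] Suc n = \<zero>"
  have "\<exists>p \<in> prime_ideals R. {\<zero>} \<subseteq> p \<and> p \<inter> ?S = {}"
  proof (rule exists_prime_avoiding[OF zeroideal])
    show "{\<zero>} \<inter> ?S = {}" using neg by (auto simp del: nat_pow_Suc)
    show "?S \<subseteq> carrier R" using a by blast
    show "s \<otimes> t \<in> ?S" if "s \<in> ?S" "t \<in> ?S" for s t
    proof -
      from that obtain m n where "s = a [^] Suc m" "t = a [^] Suc n" by blast
      then have "s \<otimes> t = a [^] Suc (m + Suc n)"
        using a by (metis add_Suc nat_pow_mult)
      then show ?thesis by blast
    qed
  qed blast
  moreover have "a [^] Suc 0 \<in> ?S" by blast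
  ultimately show False using primes a by auto
qed

section \<open>Idempotents and their basic open sets\<close>

lemma idempotent_nat_pow:
  assumes "e \<in> idempotents R"
  shows "e [^] Suc n = e"
  using assms by (induction n) (auto simp: idempotents_def)

lemma idempotent_compl:
  assumes "e \<in> idempotents R"
  shows "\<one> \<ominus> e \<in> idempotents R" "e \<otimes> (\<one> \<ominus> e) = \<zero>"
proof -
  have e: "e \<in> carrier R" "e \<otimes> e = e" using assms by (auto simp: idempotents_def)
  show *: "e \<otimes> (\<one> \<ominus> e) = \<zero>"
    using e by (simp add: minus_eq r_distr r_minus r_neg)
  have "(\<one> \<ominus> e) \<otimes> (\<one> \<ominus> e) = (\<one> \<ominus> e) \<ominus> e \<otimes> (\<one> \<ominus> e)"
    using e(1) by algebra
  then show "\<one> \<ominus> e \<in> idempotents R"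
    using e * by (simp add: idempotents_def minus_eq)
qed

text \<open>The zero product forces one of the two elements into \<open>p\<close>; the sum
  \<open>\<one>\<close> keeps them from both being there.\<close>

lemma compl_mem_prime_iff:
  assumes p: "p \<in> prime_ideals R" and ef: "e \<in> carrier R" "f \<in> carrier R"
    and "e \<otimes> f = \<zero>" "e \<oplus> f = \<one>"
  shows "f \<in> p \<longleftrightarrow> e \<notin> p"
proof -
  interpret p: primeideal p R using prime_idealsD[OF p] .
  show ?thesis
    using p.I_prime[OF ef] assms p.one_not_mem p.zero_closed p.a_closed by metis
qed

lemma basic_open_eq_zero_locus:
  assumes "e \<in> carrier R" "f \<in> carrier R" "e \<otimes> f = \<zero>" "e \<oplus> f = \<one>"
  shows "basic_open R e = zero_locus R {f}"
  using compl_mem_prime_iff[OF _ assms] by (auto simp: basic_open_def zero_locus_def)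

lemma basic_open_in_Clop:
  assumes "e \<in> idempotents R"
  shows "basic_open R e \<in> Clop (Spec R)"
proof -
  have e: "e \<in> carrier R" using assms by (simp add: idempotents_def)
  have "e \<oplus> (\<one> \<ominus> e) = \<one>" using e by algebra
  then have "basic_open R e = zero_locus R {\<one> \<ominus> e}"
    using idempotent_compl[OF assms] e by (intro basic_open_eq_zero_locus) auto
  moreover have "basic_open R e = prime_ideals R - zero_locus R {e}"
    by (auto simp: basic_open_def zero_locus_def)
  ultimately show ?thesis
    unfolding Clop_def openin_Spec[OF is_cring] closedin_Spec[OF is_cring]
    using e by (auto intro: exI[of _ "{e}"] exI[of _ "{\<one> \<ominus> e}"])
qed

text \<open>The one-sided form of injectivity: applied in both directions it gives
  \<open>e = e \<otimes> f = f\<close>.\<close>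

lemma idempotent_eq_mult_if_basic_open_subset:
  assumes e: "e \<in> idempotents R" and f: "f \<in> idempotents R"
    and sub: "basic_open R e \<subseteq> basic_open R f"
  shows "e = e \<otimes> f"
proof -
  let ?g = "e \<otimes> (\<one> \<ominus> f)"
  have carr: "e \<in> carrier R" "f \<in> carrier R" using e f by (auto simp: idempotents_def)
  have "?g \<otimes> ?g = (e \<otimes> e) \<otimes> ((\<one> \<ominus> f) \<otimes> (\<one> \<ominus> f))"
    using carr by algebra
  then have g: "?g \<in> idempotents R"
    using e idempotent_compl(1)[OF f] by (simp add: idempotents_def)
  have "?g \<in> p" if p: "p \<in> prime_ideals R" for p
  proof -
    interpret p: primeideal p R using prime_idealsD[OF p] .
    \<comment> \<open>A prime missing \<open>e\<close> also misses \<open>f\<close>, hence contains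
      \<open>\<one> \<ominus> f\<close>.\<close>
    have "e \<in> p \<or> f \<notin> p" using sub p by (auto simp: basic_open_def)
    moreover have "f \<notin> p \<Longrightarrow> \<one> \<ominus> f \<in> p"
      using p.I_prime[of f "\<one> \<ominus> f"] idempotent_compl(2)[OF f] carr by auto
    ultimately show ?thesis
      using p.I_l_closed[of "\<one> \<ominus> f" e] p.I_r_closed[of e "\<one> \<ominus> f"] carr by auto
  qed
  moreover have "?g \<in> carrier R" using carr by simp
  \<comment> \<open>Some positive power of \<open>?g\<close> vanishes, and an idempotent equals each
    of its positive powers.\<close>
  ultimately have "?g = \<zero>"
    using nilpotent_if_in_all_primes idempotent_nat_pow[OF g] by metis
  moreover have "e = ?g \<oplus> e \<otimes> f" using carr by algebra
  ultimately show ?thesis using carr by simp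
qed

lemma inj_on_basic_open: "inj_on (basic_open R) (idempotents R)"
proof (rule inj_onI)
  fix e f assume ef: "e \<in> idempotents R" "f \<in> idempotents R" "basic_open R e = basic_open R f"
  then have "e = e \<otimes> f" "f = f \<otimes> e"
    by (simp_all add: idempotent_eq_mult_if_basic_open_subset)
  then show "e = f" using ef m_comm by (auto simp: idempotents_def)
qed

section \<open>From clopen sets back to idempotents\<close>

lemma exists_idempotent_for_Clop:
  assumes U: "U \<in> Clop (Spec R)"
  shows "\<exists>e \<in> idempotents R. U = basic_open R e"
proof -
  obtain E F where E: "E \<subseteq> carrier R" "U = prime_ideals R - zero_locus R E"
    and F: "F \<subseteq> carrier R" "U = zero_locus R F"
    using U unfolding Clop_def openin_Spec[OF is_cring] closedin_Spec[OF is_cring] by blast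
  \<comment> \<open>\<open>U\<close> is both \<open>zero_locus R F\<close> and the complement of
    \<open>zero_locus R E\<close>, so the two loci partition the spectrum.\<close>
  have not_both: "\<not> (E \<subseteq> p \<and> F \<subseteq> p)" and one_of: "E \<subseteq> p \<or> F \<subseteq> p" if "p \<in> prime_ideals R" for p
    using that E(2) F(2) by (auto simp: zero_locus_def)
  have Idl_sub: "Idl X \<subseteq> p \<longleftrightarrow> X \<subseteq> p" if "p \<in> prime_ideals R" "X \<subseteq> carrier R" for p X
    using Idl_subset_ideal[of p X] prime_idealsD[OF that(1)] that(2)
    by (simp add: primeideal.axioms)
  obtain a b where a: "a \<in> Idl E" and b: "b \<in> Idl F" and ab: "a \<oplus> b = \<one>"
    using coprime_ideals_decompose_one[OF genideal_ideal[OF E(1)] genideal_ideal[OF F(1)]]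
      Idl_sub E(1) F(1) not_both by metis
  have carr: "a \<in> carrier R" "b \<in> carrier R"
    using a b genideal_ideal E F ideal.Icarr by metis+
  have "a \<otimes> b \<in> p" if p: "p \<in> prime_ideals R" for p
  proof -
    interpret p: primeideal p R using prime_idealsD[OF p] .
    have "a \<in> p \<or> b \<in> p" using one_of[OF p] Idl_sub[OF p] E F a b by blast
    then show ?thesis using carr p.I_l_closed p.I_r_closed by blast
  qed
  then obtain n :: nat where "(a \<otimes> b) [^] Suc n = \<zero>"
    using nilpotent_if_in_all_primes carr by blast
  then have pow0: "a [^] Suc n \<otimes> b [^] Suc n = \<zero>"
    using nat_pow_distrib carr by metis
  \<comment> \<open>Passing to powers makes the product zero without changing which primes contain
    the elements, so the two principal ideals are still comaximal.\<close>
  define a' b' where "a' = a [^] Suc n" and "b' = b [^] Suc n"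
  have carr': "a' \<in> carrier R" "b' \<in> carrier R" and "a' \<otimes> b' = \<zero>"
    using carr pow0 unfolding a'_def b'_def by (auto simp del: nat_pow_Suc)
  have pow_mem: "a' \<in> p \<longleftrightarrow> a \<in> p" "b' \<in> p \<longleftrightarrow> b \<in> p" if "p \<in> prime_ideals R" for p
    using primeideal.nat_pow_mem_iff prime_idealsD[OF that] carr unfolding a'_def b'_def by metis+
  have "False" if p: "p \<in> prime_ideals R" and "PIdl a' \<subseteq> p" "PIdl b' \<subseteq> p" for p
  proof -
    interpret p: primeideal p R using prime_idealsD[OF p] .
    have "a \<in> p" "b \<in> p"
      using that cgenideal_self carr' pow_mem[OF p] by blast+
    then show False using ab p.a_closed p.one_not_mem by metis
  qed
  then obtain e f where e: "e \<in> PIdl a'" and f: "f \<in> PIdl b'" and ef: "e \<oplus> f = \<one>"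
    using coprime_ideals_decompose_one cgenideal_ideal carr' by metis
  then obtain x y where x: "x \<in> carrier R" "e = x \<otimes> a'" and y: "y \<in> carrier R" "f = y \<otimes> b'"
    unfolding cgenideal_def by blast
  have efc: "e \<in> carrier R" "f \<in> carrier R" using x y carr' by auto
  have "e \<otimes> f = x \<otimes> y \<otimes> (a' \<otimes> b')" using x y carr' by algebra
  then have ef0: "e \<otimes> f = \<zero>" using \<open>a' \<otimes> b' = \<zero>\<close> x y by simp
  have "e = e \<otimes> (e \<oplus> f)" using ef efc by simp
  also have "\<dots> = e \<otimes> e \<oplus> e \<otimes> f" using efc by algebra
  finally have "e \<in> idempotents R" using ef0 efc by (simp add: idempotents_def)
  moreover have "p \<in> U \<longleftrightarrow> p \<in> basic_open R e" if p: "p \<in> prime_ideals R" for p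
  proof -
    interpret p: primeideal p R using prime_idealsD[OF p] .
    \<comment> \<open>Since \<open>e\<close> is a multiple of \<open>a'\<close>, a prime containing
      \<open>E\<close> contains in turn \<open>a\<close>, \<open>a'\<close> and \<open>e\<close>;
      likewise for \<open>F\<close> and \<open>f\<close>.\<close>
    have "E \<subseteq> p \<Longrightarrow> e \<in> p" "F \<subseteq> p \<Longrightarrow> f \<in> p"
      using Idl_sub[OF p] E F a b pow_mem[OF p] x y p.I_l_closed by blast+
    then show ?thesis
      using one_of[OF p] not_both[OF p] compl_mem_prime_iff[OF p efc ef0 ef] p E(2)
      by (auto simp: basic_open_def zero_locus_def)
  qed
  moreover have "U \<subseteq> prime_ideals R" "basic_open R e \<subseteq> prime_ideals R"
    using E(2) by (auto simp: basic_open_def)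
  ultimately show ?thesis by blast
qed

lemma Clop_Spec_eq: "Clop (Spec R) = basic_open R ` idempotents R"
proof
  show "Clop (Spec R) \<subseteq> basic_open R ` idempotents R"
    using exists_idempotent_for_Clop by auto
  show "basic_open R ` idempotents R \<subseteq> Clop (Spec R)"
    using basic_open_in_Clop by auto
qed

end

section \<open>Naturality and the equivalence\<close>

lemma Clop_map_basic_open:
  assumes "cring R" "cring R'" "\<phi> \<in> ring_hom R R'" "e \<in> carrier R"
  shows "Clop_map (Spec R') (spec_map R \<phi>) (basic_open R e) = basic_open R' (\<phi> e)"
proof -
  have "spec_map R \<phi> p \<in> prime_ideals R" if "p \<in> prime_ideals R'" for p
    using continuous_map_spec_map[OF assms(1-3)] that
    by (auto simp: continuous_map_def topspace_Spec assms(1,2))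
  then show ?thesis
    using assms(4)
    by (auto simp: Clop_map_def basic_open_def topspace_Spec[OF assms(2)] spec_map_def)
qed

lemma idempotents_image:
  assumes "\<phi> \<in> ring_hom R R'" "e \<in> idempotents R"
  shows "\<phi> e \<in> idempotents R'"
  using assms ring_hom_closed[OF assms(1)] ring_hom_mult[OF assms(1), of e e]
  by (auto simp: idempotents_def)

theorem lemma3p1:
  fixes R :: "('a, 'm) ring_scheme" and R' :: "('b, 'n) ring_scheme" and \<phi> :: "'a \<Rightarrow> 'b"
  assumes "cring R" and "cring R'" and "\<phi> \<in> ring_hom R R'"
  shows "lifts_idempotents R R' \<phi> \<longleftrightarrow>
    Clop_map (Spec R') (spec_map R \<phi>) ` Clop (Spec R) = Clop (Spec R')"
    (is "_ \<longleftrightarrow> ?f ` _ = _")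
proof -
  have Clop_eq: "Clop (Spec R) = basic_open R ` idempotents R"
    "Clop (Spec R') = basic_open R' ` idempotents R'"
    by (rule cring.Clop_Spec_eq, fact assms)+
  have "?f ` Clop (Spec R) = basic_open R' ` \<phi> ` idempotents R"
    unfolding Clop_eq image_image
    using Clop_map_basic_open[OF assms] by (intro image_cong) (auto simp: idempotents_def)
  also have "\<dots> = Clop (Spec R') \<longleftrightarrow> \<phi> ` idempotents R = idempotents R'"
    unfolding Clop_eq
    by (rule inj_on_image_eq_iff[OF cring.inj_on_basic_open[OF assms(2)]])
      (auto intro: idempotents_image[OF assms(3)])
  also have "\<dots> \<longleftrightarrow> lifts_idempotents R R' \<phi>"
  proof -
    \<comment> \<open>With this inclusion, equality of the two sets reduces to the reverse
      inclusion, which is lifting.\<close>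
    have "\<phi> ` idempotents R \<subseteq> idempotents R'"
      using idempotents_image[OF assms(3)] by auto
    then show ?thesis
      unfolding lifts_idempotents_def set_eq_subset subset_iff image_iff by metis
  qed
  finally show ?thesis by simp
qed

end
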